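(* Let $f \in \mathbb{Z}[x]$ be a polynomial of degree $d \ge 3$. If $x^2 \nmid f(x)$, then there is a square-free polynomial $g \in \mathbb{Z}[x]$ with $$\deg g < 2.2\, d \Big(\frac{\log d}{\log\log d}\Big)^3 \log L(f) \quad\text{and}\quad L(f-g)=1.$$ In every case (in particular when $x^2 \mid f(x)$), there is a square-free polynomial $g \in \mathbb{Z}[x]$ with $$\deg g < 2.2\, d \Big(\frac{\log d}{\log\log d}\Big)^3 \log (L(f)+1) \quad\text{and}\quad L(f-g)\le 2,$$ where, if $x^2\mid f(x)$, one has $L(f-g)=2$.
   Context: Here $\log$ is the natural logarithm. For $h(x) = a_n x^n + \cdots + a_0 \in \mathbb{Z}[x]$, its length is $L(h) = |a_n| + |a_{n-1}| + \cdots + |a_0|$. A polynomial $g \in \mathbb{Z}[x]$ is called square-free if there is no polynomial $h \in \mathbb{Z}[x]$ of degree at least $1$ such that $h^2$ divides $g$. *)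

theory Defs
  imports Complex_Main "HOL-Computational_Algebra.Polynomial"
begin

definition poly_len :: "int poly \<Rightarrow> int" where
  "poly_len h = (\<Sum>i\<le>degree h. \<bar>coeff h i\<bar>)"

text \<open>Only non-constant square divisors are excluded, so content is irrelevant:
  \<open>4 x\<close> is square-free here although it is not \<open>squarefree\<close> in the sense of the
  library. The zero polynomial is not square-free.\<close>

definition square_free_poly :: "int poly \<Rightarrow> bool" where
  "square_free_poly g \<longleftrightarrow> \<not> (\<exists>h :: int poly. degree h \<ge> 1 \<and> h ^ 2 dvd g)"

end

theory Submission
  imports Defs "HOL-Computational_Algebra.Computational_Algebra"
begin

text \<open>Take \<open>g = f + x\<^sup>n\<close> with \<open>n > d\<close> (and \<open>f + 1\<close> instead of \<open>f\<close> if \<open>x\<^sup>2\<close> divides \<open>f\<close>). If \<open>g\<close> is not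
  square-free, there is a monic prime \<open>h\<close> of positive degree with \<open>h\<^sup>2\<close> dividing \<open>g\<close>; it divides
  \<open>x f' - n f\<close>, so its degree is at most \<open>d\<close>, and distinct \<open>n\<close> have distinct \<open>h\<close>.

  If \<open>h\<close> is self-reciprocal up to sign, then \<open>h\<^sup>2\<close> divides \<open>f f\<^sup>* - x\<^sup>d\<close>, where \<open>f\<^sup>*\<close> is the reversal
  of \<open>f\<close>. This polynomial is nonzero and has degree at most \<open>2 d\<close>, so at most \<open>d\<close> exponents
  \<open>n\<close> arise in this way. Otherwise Smyth's argument bounds the Mahler measure of \<open>h\<close> from below by
  an absolute constant, so \<open>h\<close> has a root \<open>a\<close> with \<open>1/10 \<le> d ln |a|\<close>; since \<open>a\<^sup>n = - f(a)\<close>, this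
  forces \<open>n \<le> d + 10 d ln L(f)\<close>. Hence one of the next \<open>d + 1\<close> exponents works. The bound is
  linear in \<open>d\<close>, so no estimate of Dobrowolski type for reciprocal \<open>h\<close> is needed.\<close>

section \<open>Truncated Hardy space estimates for Blaschke products\<close>

text \<open>Truncated form of the fact that multiplication by a Blaschke factor is an isometry of the
  Hardy space. It is a telescoping identity, so no convergence of the power series is involved.\<close>

lemma blaschke_partial_sums:
  fixes w :: "complex fps"
  shows "(\<Sum>i\<le>N. (cmod (((1 - fps_const (cnj a) * fps_X) * w) $ i))\<^sup>2) -
         (\<Sum>i\<le>N. (cmod (((fps_X - fps_const a) * w) $ i))\<^sup>2) = (1 - (cmod a)\<^sup>2) * (cmod (w $ N))\<^sup>2"
proof (induction N)
  case 0
  show ?case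
    by (simp add: algebra_simps norm_mult power_mult_distrib fps_mult_nth)
next
  case (Suc N)
  define x y where "x = w $ Suc N" and "y = w $ N"
  have 1: "((1 - fps_const (cnj a) * fps_X) * w) $ Suc N = x - cnj a * y"
    by (simp add: ring_distribs mult.assoc x_def y_def)
  have 2: "((fps_X - fps_const a) * w) $ Suc N = y - a * x"
    by (simp add: ring_distribs mult.assoc x_def y_def)
  have "(cmod (x - cnj a * y))\<^sup>2 - (cmod (y - a * x))\<^sup>2 = (1 - (cmod a)\<^sup>2) * ((cmod x)\<^sup>2 - (cmod y)\<^sup>2)"
    unfolding cmod_power2 by (simp add: power2_eq_square algebra_simps)
  with Suc.IH show ?case
    unfolding sum.atMost_Suc 1 2 x_def[symmetric] y_def[symmetric] by (simp add: algebra_simps)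
qed

text \<open>Induction over the zeros: if the old product is \<open>(1 - cnj a X) w\<close>, the new
  one is \<open>(X - a) w\<close>, and \<open>blaschke_partial_sums\<close> shows that no partial
  sum grows, since \<open>1 - |a|^2\<close> is nonnegative.\<close>

lemma blaschke_inside:
  assumes "\<And>a. a \<in># A \<Longrightarrow> cmod a \<le> 1"
  shows "(\<Sum>i\<le>N. (cmod ((\<Prod>a\<in>#A. (fps_X - fps_const a) *
            inverse (1 - fps_const (cnj a) * fps_X)) $ i))\<^sup>2) \<le> 1"
  using assms
proof (induction A)
  case empty
  have "(\<Sum>i\<le>N. (cmod ((1 :: complex fps) $ i))\<^sup>2) = (\<Sum>i\<le>N. if i = 0 then 1 else 0)"
    by (intro sum.cong) auto
  then show ?case by simp
next
  case (add a A)
  define u where "u = (\<Prod>a\<in>#A. (fps_X - fps_const a) * inverse (1 - fps_const (cnj a) * fps_X))"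
  define w where "w = inverse (1 - fps_const (cnj a) * fps_X) * u"
  have "(1 - fps_const (cnj a) * fps_X) * w = u"
    unfolding w_def mult.assoc[symmetric] by (subst inverse_mult_eq_1') auto
  moreover have "(1 - (cmod a)\<^sup>2) * (cmod (w $ N))\<^sup>2 \<ge> 0"
    using add.prems by (simp add: power_le_one)
  moreover have "(\<Sum>i\<le>N. (cmod (u $ i))\<^sup>2) \<le> 1" using add by (simp add: u_def)
  ultimately have "(\<Sum>i\<le>N. (cmod (((fps_X - fps_const a) * w) $ i))\<^sup>2) \<le> 1"
    using blaschke_partial_sums[of a w N] by simp
  then show ?case by (simp add: w_def u_def mult.assoc)
qed

text \<open>Inverting the factors and changing the sign of \<open>1 - |a|^2\<close> cancel out, so
  the same telescoping applies. The inverses are power series because \<open>a\<close> is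
  nonzero.\<close>

lemma blaschke_outside:
  assumes "\<And>a. a \<in># A \<Longrightarrow> cmod a > 1"
  shows "(\<Sum>i\<le>N. (cmod ((\<Prod>a\<in>#A. (1 - fps_const (cnj a) * fps_X) *
            inverse (fps_X - fps_const a)) $ i))\<^sup>2) \<le> 1"
  using assms
proof (induction A)
  case empty
  have "(\<Sum>i\<le>N. (cmod ((1 :: complex fps) $ i))\<^sup>2) = (\<Sum>i\<le>N. if i = 0 then 1 else 0)"
    by (intro sum.cong) auto
  then show ?case by simp
next
  case (add a A)
  define u where "u = (\<Prod>a\<in>#A. (1 - fps_const (cnj a) * fps_X) * inverse (fps_X - fps_const a))"
  define w where "w = inverse (fps_X - fps_const a) * u"
  have "cmod a > 1" using add.prems by simp
  then have "(fps_X - fps_const a) * w = u"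
    unfolding w_def mult.assoc[symmetric] by (subst inverse_mult_eq_1') auto
  moreover have "(1 - (cmod a)\<^sup>2) * (cmod (w $ N))\<^sup>2 \<le> 0"
    using \<open>cmod a > 1\<close> by (simp add: mult_le_0_iff)
  moreover have "(\<Sum>i\<le>N. (cmod (u $ i))\<^sup>2) \<le> 1" using add by (simp add: u_def)
  ultimately have "(\<Sum>i\<le>N. (cmod (((1 - fps_const (cnj a) * fps_X) * w) $ i))\<^sup>2) \<le> 1"
    using blaschke_partial_sums[of a w N] by simp
  then show ?case by (simp add: w_def u_def mult.assoc)
qed

lemma two_coeffs_le:
  fixes u :: "complex fps"
  assumes "(\<Sum>i\<le>j. (cmod (u $ i))\<^sup>2) \<le> 1" and "j > 0"
  shows "(cmod (u $ 0))\<^sup>2 + (cmod (u $ j))\<^sup>2 \<le> 1"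
proof -
  have "(\<Sum>i\<in>{0, j}. (cmod (u $ i))\<^sup>2) \<le> (\<Sum>i\<le>j. (cmod (u $ i))\<^sup>2)"
    by (rule sum_mono2) auto
  with assms show ?thesis by simp
qed

section \<open>Smyth's lower bound for the Mahler measure\<close>

text \<open>Reversal turns \<open>x - a\<close> into \<open>1 - a x\<close>, and real coefficients
  allow \<open>a\<close> to be replaced by \<open>cnj a\<close>. The conjugated form matches the
  Blaschke denominators.\<close>

lemma complex_conjugate_linear_factors:
  fixes h :: "complex poly"
  assumes "\<And>i. coeff h i \<in> \<real>" and "lead_coeff h = 1"
  shows "reflect_poly h = (\<Prod>a\<in>#proots h. [:1, - cnj a:])"
proof -
  have "reflect_poly (\<Prod>a\<in>#A. [:- a, 1:]) = (\<Prod>a\<in>#A. [:1, - a:])" for A :: "complex multiset"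
    by (induction A)
      (simp_all add: reflect_poly_mult reflect_poly_pCons' monom_altdef del: mult_pCons_left)
  from this[of "proots h"] have *: "reflect_poly h = (\<Prod>a\<in>#proots h. [:1, - a:])"
    using complex_poly_decompose_multiset[of h] assms by simp
  have "poly (reflect_poly h) x = poly (\<Prod>a\<in>#proots h. [:1, - cnj a:]) x" for x
  proof -
    have "map_poly cnj (reflect_poly h) = reflect_poly h"
      using assms(1) by (intro poly_eqI) (simp add: coeff_map_poly coeff_reflect_poly Reals_cnj_iff)
    then have "poly (reflect_poly h) x = cnj (poly (\<Prod>a\<in>#proots h. [:1, - a:]) (cnj x))"
      using poly_map_poly_cnj[of "reflect_poly h" x] by (simp add: *)
    moreover have "cnj (poly (\<Prod>a\<in>#A. [:1, - a:]) (cnj x)) = poly (\<Prod>a\<in>#A. [:1, - cnj a:]) x"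
      for A :: "complex multiset"
      by (induction A) auto
    ultimately show ?thesis by simp
  qed
  then show ?thesis by (simp add: poly_eq_poly_eq_iff[symmetric] fun_eq_iff)
qed

lemma fps_of_poly_prod_mset: "fps_of_poly (\<Prod>x\<in>#A. f x) = (\<Prod>x\<in>#A. fps_of_poly (f x))"
  by (induction A) (simp_all add: fps_of_poly_mult)


lemma fps_mult_nth_leading:
  fixes f g :: "'a :: comm_ring_1 fps"
  assumes "\<And>i. i < j \<Longrightarrow> f $ i = 0"
  shows "(f * g) $ j = f $ j * g $ 0"
proof -
  have "(f * g) $ j = (\<Sum>i\<in>{0..j}. f $ i * g $ (j - i))" by (rule fps_mult_nth)
  also have "\<dots> = (\<Sum>i\<in>{j}. f $ i * g $ (j - i))"
    using assms by (intro sum.mono_neutral_right) auto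
  finally show ?thesis by simp
qed

lemma cmod_prod_mset: "cmod (\<Prod>a\<in>#A. f a) = (\<Prod>a\<in>#A. cmod (f a))"
  by (induction A) (simp_all add: norm_mult)

lemma prod_mset_cmod_nonneg: "0 \<le> (\<Prod>a\<in>#A. cmod a)"
  by (induction A) simp_all

lemma prod_mset_cmod_le_power:
  assumes "\<And>a. a \<in># A \<Longrightarrow> cmod a \<le> c"
  shows "(\<Prod>a\<in>#A. cmod a) \<le> c ^ size A"
  using assms
proof (induction A)
  case (add a A)
  then show ?case by (auto intro!: mult_mono prod_mset_cmod_nonneg intro: order_trans[OF norm_ge_zero])
qed simp

text \<open>Smyth's argument: with \<open>P\<close> and \<open>Q\<close> the (inverse) Blaschke products over the roots inside and
  outside the unit disc, \<open>h / h\<^sup>* = P / Q\<close>. This is \<open>\<plusminus>1\<close> plus a nonzero integer multiple of \<open>x\<^sup>j\<close>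
  plus higher terms, so \<open>\<bar>Q\<^sub>0\<bar> \<le> \<bar>P\<^sub>j\<bar> + \<bar>Q\<^sub>j\<bar>\<close>, while \<open>\<bar>P\<^sub>0\<bar> = \<bar>Q\<^sub>0\<bar>\<close> is the inverse of the
  Mahler measure.\<close>

lemma nonreciprocal_unit_mahler_bound:
  fixes h :: "int poly"
  assumes "lead_coeff h = 1" and "\<bar>coeff h 0\<bar> = 1"
    and "reflect_poly h \<noteq> h" and "reflect_poly h \<noteq> - h"
  defines "B \<equiv> filter_mset (\<lambda>a. cmod a > 1) (proots (map_poly of_int h :: complex poly))"
  shows "5 / 4 \<le> (\<Prod>a\<in>#B. cmod a)\<^sup>2"
proof -
  define H :: "complex poly" where "H = map_poly of_int h"
  define A where "A = filter_mset (\<lambda>a. cmod a \<le> 1) (proots H)"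
  have AB: "proots H = A + B"
    by (metis (no_types, lifting) A_def B_def H_def filter_mset_cong multiset_partition not_le)
  have lead: "lead_coeff H = 1" and cH: "coeff H i = of_int (coeff h i)" for i
    using assms(1) by (simp_all add: H_def coeff_map_poly degree_map_poly)
  define P where "P = (\<Prod>a\<in>#A. (fps_X - fps_const a) * inverse (1 - fps_const (cnj a) * fps_X))"
  define Q where "Q = (\<Prod>a\<in>#B. (1 - fps_const (cnj a) * fps_X) * inverse (fps_X - fps_const a))"
  define K where "K = fps_of_poly (reflect_poly H)"
  have P_le: "(\<Sum>i\<le>N. (cmod (P $ i))\<^sup>2) \<le> 1" for N
    unfolding P_def by (rule blaschke_inside) (auto simp: A_def)
  have Q_le: "(\<Sum>i\<le>N. (cmod (Q $ i))\<^sup>2) \<le> 1" for N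
    unfolding Q_def by (rule blaschke_outside) (auto simp: B_def)
  have lin: "fps_of_poly [:- a, 1:] = fps_X - fps_const a"
    "fps_of_poly [:1, - cnj a:] = 1 - fps_const (cnj a) * fps_X" for a :: complex
    by (simp_all add: fps_of_poly_pCons)
  have H_eq: "fps_of_poly H = (\<Prod>a\<in>#A. fps_X - fps_const a) * (\<Prod>a\<in>#B. fps_X - fps_const a)"
    using complex_poly_decompose_multiset[of H] lead AB
    by (simp flip: fps_of_poly_prod_mset fps_of_poly_mult lin(1))
  have K_eq: "K = (\<Prod>a\<in>#A. 1 - fps_const (cnj a) * fps_X) * (\<Prod>a\<in>#B. 1 - fps_const (cnj a) * fps_X)"
    unfolding K_def using complex_conjugate_linear_factors[of H] lead AB cH
    by (simp flip: fps_of_poly_prod_mset fps_of_poly_mult lin(2))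
  have PA: "P * (\<Prod>a\<in>#A. 1 - fps_const (cnj a) * fps_X) = (\<Prod>a\<in>#A. fps_X - fps_const a)"
    unfolding P_def prod_mset.distrib[symmetric] mult.assoc
    by (intro arg_cong[where f = prod_mset] image_mset_cong) (subst inverse_mult_eq_1; simp)
  have QB: "Q * (\<Prod>a\<in>#B. fps_X - fps_const a) = (\<Prod>a\<in>#B. 1 - fps_const (cnj a) * fps_X)"
    unfolding Q_def prod_mset.distrib[symmetric] mult.assoc
    by (intro arg_cong[where f = prod_mset] image_mset_cong)
      (subst inverse_mult_eq_1; force simp: B_def)
  have "P * K = (\<Prod>a\<in>#A. fps_X - fps_const a) * (\<Prod>a\<in>#B. 1 - fps_const (cnj a) * fps_X)"
    by (simp only: K_eq PA flip: mult.assoc)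
  then have PK: "P * K = Q * fps_of_poly H"
    by (simp only: H_eq QB mult.left_commute[of Q])
  define e where "e = coeff h 0"
  have e: "e = 1 \<or> e = -1" using assms(2) by (auto simp: e_def)
  \<comment> \<open>\<open>D\<close> is nonzero because \<open>h\<close> is not reciprocal up to
    sign, and its constant term \<open>e - e\<close> vanishes because \<open>h\<close> is monic.
    Hence its lowest exponent \<open>j\<close> is positive.\<close>
  define D where "D = h - smult e (reflect_poly h)"
  have "D \<noteq> 0" using e assms(3,4) by (auto simp: D_def)
  define j where "j = (LEAST i. coeff D i \<noteq> 0)"
  have "\<exists>i. coeff D i \<noteq> 0" using \<open>D \<noteq> 0\<close> by (auto simp: poly_eq_iff)
  then have Dj: "coeff D j \<noteq> 0" unfolding j_def by (rule LeastI_ex)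
  have Di: "coeff D i = 0" if "i < j" for i
    using that not_less_Least unfolding j_def by blast
  have "coeff D 0 = 0" using assms(1) by (simp add: D_def e_def)
  then have "j > 0" using Dj by (cases j) auto
  have K0: "K $ 0 = 1" using lead by (simp add: K_def)
  have "of_int (coeff D i) = (fps_of_poly H - fps_const (of_int e) * K) $ i" for i
    by (simp add: D_def K_def cH coeff_reflect_poly H_def degree_map_poly coeff_map_poly)
  then have D_eq: "fps_of_poly (map_poly of_int D) = fps_of_poly H - fps_const (of_int e) * K"
    by (intro fps_ext) (simp add: coeff_map_poly)
  have "(P - fps_const (of_int e) * Q) * K = Q * fps_of_poly (map_poly of_int D)"
    unfolding D_eq using PK by (simp add: algebra_simps)
  \<comment> \<open>\<open>K\<close> has constant term 1, so it can be divided out: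
    \<open>P - e Q\<close> inherits the order \<open>j\<close> of \<open>D\<close>, and its
    coefficient there is \<open>D_j Q_0\<close>.\<close>
  from arg_cong[OF this, of "\<lambda>u. u * inverse K"]
  have eq: "P - fps_const (of_int e) * Q = fps_of_poly (map_poly of_int D) * (Q * inverse K)"
    using K0 by (simp add: mult.assoc inverse_mult_eq_1' mult.left_commute[of Q])
  have "(P - fps_const (of_int e) * Q) $ j = of_int (coeff D j) * Q $ 0"
    unfolding eq using K0 Di by (subst fps_mult_nth_leading) (simp_all add: coeff_map_poly)
  moreover have "(P - fps_const (of_int e) * Q) $ 0 = 0"
    unfolding eq using Di[OF \<open>j > 0\<close>] by (simp add: coeff_map_poly)
  ultimately have Pj: "P $ j - of_int e * Q $ j = of_int (coeff D j) * Q $ 0"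
    and P0: "P $ 0 = of_int e * Q $ 0" by simp_all
  have ce: "cmod (of_int e) = 1" using e by auto
  define t where "t = cmod (Q $ 0)"
  have "1 \<le> \<bar>real_of_int (coeff D j)\<bar>" using Dj by linarith
  then have "t \<le> \<bar>real_of_int (coeff D j)\<bar> * t" unfolding t_def by (simp add: mult_le_cancel_right1)
  also have "\<dots> = cmod (P $ j - of_int e * Q $ j)" unfolding Pj t_def by (simp add: norm_mult)
  also have "\<dots> \<le> cmod (P $ j) + cmod (Q $ j)"
    using norm_triangle_ineq4[of "P $ j" "of_int e * Q $ j"] ce by (simp add: norm_mult)
  finally have "t\<^sup>2 \<le> (cmod (P $ j) + cmod (Q $ j))\<^sup>2" by (simp add: t_def power_mono)
  also have "\<dots> \<le> 2 * (cmod (P $ j))\<^sup>2 + 2 * (cmod (Q $ j))\<^sup>2"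
    using sum_squares_bound[of "cmod (P $ j)" "cmod (Q $ j)"] by (simp add: power2_sum)
  \<comment> \<open>Since \<open>|P_0| = |Q_0| = t\<close>, at most \<open>1 - t^2\<close> is left
    for each of \<open>|P_j|^2\<close> and \<open>|Q_j|^2\<close>.\<close>
  also have "\<dots> \<le> 4 - 4 * t\<^sup>2"
    using two_coeffs_le[OF P_le \<open>j > 0\<close>] two_coeffs_le[OF Q_le \<open>j > 0\<close>] ce
    by (simp add: P0 t_def norm_mult)
  finally have t: "t\<^sup>2 \<le> 4 / 5" by simp
  have "Q $ 0 = (\<Prod>a\<in>#B. - inverse a)"
    unfolding Q_def by (induction B) simp_all
  then have "t = (\<Prod>a\<in>#B. inverse (cmod a))" unfolding t_def by (simp add: cmod_prod_mset norm_inverse)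
  also have "\<dots> = inverse (\<Prod>a\<in>#B. cmod a)" by (induction B) simp_all
  finally have "t\<^sup>2 = inverse ((\<Prod>a\<in>#B. cmod a)\<^sup>2)" by (simp add: power_inverse)
  moreover have "(\<Prod>a\<in>#B. cmod a) \<noteq> 0" by (auto simp: B_def)
  ultimately show ?thesis using t by (simp add: field_simps)
qed

text \<open>At most \<open>degree h\<close> roots lie outside the disc, so the largest modulus to
  that power dominates the Mahler measure. If \<open>|h(0)| >= 2\<close>, the measure is at least 2
  because \<open>|h(0)|\<close> is the product of the moduli of all roots; otherwise Smyth's bound
  applies.\<close>

lemma nonreciprocal_large_root:
  fixes h :: "int poly"
  assumes "lead_coeff h = 1" and "coeff h 0 \<noteq> 0"
    and "reflect_poly h \<noteq> h" and "reflect_poly h \<noteq> - h"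
  obtains a :: complex where "poly (map_poly of_int h) a = 0" and "cmod a > 1"
    and "5 / 4 \<le> cmod a ^ (2 * degree h)"
proof -
  define H :: "complex poly" where "H = map_poly of_int h"
  define A where "A = filter_mset (\<lambda>a. cmod a \<le> 1) (proots H)"
  define B where "B = filter_mset (\<lambda>a. cmod a > 1) (proots H)"
  have AB: "proots H = A + B"
    by (metis (no_types, lifting) A_def B_def filter_mset_cong multiset_partition not_le)
  have lead: "lead_coeff H = 1" and cH: "coeff H i = of_int (coeff h i)"
    and deg: "degree H = degree h" for i
    using assms(1) by (simp_all add: H_def coeff_map_poly degree_map_poly)
  have M: "5 / 4 \<le> (\<Prod>a\<in>#B. cmod a)\<^sup>2"
  proof (cases "\<bar>coeff h 0\<bar> = 1")
    case True
    show ?thesis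
      using nonreciprocal_unit_mahler_bound[OF assms(1) True assms(3,4)] by (simp add: B_def H_def)
  next
    case False
    have "poly (\<Prod>a\<in>#C. [:- a, 1:]) 0 = (\<Prod>a\<in>#C. - a)" for C :: "complex multiset"
      by (induction C) auto
    from this[of "proots H"] have "poly H 0 = (\<Prod>a\<in>#proots H. - a)"
      using complex_poly_decompose_multiset[of H] lead by simp
    then have "cmod (poly H 0) = (\<Prod>a\<in>#proots H. cmod a)" by (simp add: cmod_prod_mset)
    then have "real_of_int \<bar>coeff h 0\<bar> = (\<Prod>a\<in>#proots H. cmod a)" by (simp add: poly_0_coeff_0 cH)
    also have "\<dots> = (\<Prod>a\<in>#A. cmod a) * (\<Prod>a\<in>#B. cmod a)" by (simp add: AB)
    also have "\<dots> \<le> 1 * (\<Prod>a\<in>#B. cmod a)"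
      using prod_mset_cmod_le_power[of A 1] by (intro mult_right_mono prod_mset_cmod_nonneg) (auto simp: A_def)
    finally have "real_of_int \<bar>coeff h 0\<bar> \<le> (\<Prod>a\<in>#B. cmod a)" by simp
    moreover have "real_of_int \<bar>coeff h 0\<bar> \<ge> 2" using assms(2) False by linarith
    ultimately have "2 \<le> (\<Prod>a\<in>#B. cmod a)" by linarith
    from power_mono[OF this, of 2] show ?thesis by simp
  qed
  then have "B \<noteq> {#}" by auto
  define c where "c = Max (cmod ` set_mset B)"
  have "c \<in> cmod ` set_mset B" unfolding c_def using \<open>B \<noteq> {#}\<close> by (intro Max_in) auto
  then obtain a where a: "a \<in># B" "c = cmod a" by auto
  have "cmod a > 1" using a by (simp add: B_def)
  have "(\<Prod>a\<in>#B. cmod a) \<le> cmod a ^ size B"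
    unfolding a(2)[symmetric] by (rule prod_mset_cmod_le_power) (simp add: c_def)
  also have "size B \<le> degree h"
    using size_proots_le[of H] by (simp add: AB deg)
  then have "cmod a ^ size B \<le> cmod a ^ degree h" using \<open>cmod a > 1\<close> by simp
  finally have "(\<Prod>a\<in>#B. cmod a)\<^sup>2 \<le> (cmod a ^ degree h)\<^sup>2"
    by (intro power_mono prod_mset_cmod_nonneg) auto
  with M have "5 / 4 \<le> cmod a ^ (2 * degree h)" by (simp add: power_mult power2_eq_square power_mult_distrib)
  moreover have "poly H a = 0" using a lead by (cases "H = 0") (auto simp: B_def)
  ultimately show thesis using that \<open>cmod a > 1\<close> by (simp add: H_def)
qed

section \<open>Divisibility by powers of \<open>x\<close>, and the length of a polynomial\<close>

lemma x_power_dvd_iff: "[:0, 1:] ^ n dvd p \<longleftrightarrow> (\<forall>i<n. coeff p i = (0 :: int))"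
  by (simp add: monom_1_dvd_iff' flip: monom_altdef[of 1, simplified])

text \<open>Reversal sends \<open>x^n\<close> to 1, so the reversal of \<open>h\<close> is a unit;
  the nonzero constant term ensures that reversal keeps the degree.\<close>

lemma dvd_monom_imp_degree_0:
  fixes h :: "int poly"
  assumes "h dvd monom 1 n" and "coeff h 0 \<noteq> 0"
  shows "degree h = 0"
proof -
  from assms(1) obtain k where k: "monom 1 n = h * k" by (rule dvdE)
  have "reflect_poly (monom (1 :: int) n) = 1"
    by (rule poly_eqI) (auto simp: coeff_reflect_poly degree_monom_eq coeff_1)
  then have "reflect_poly h * reflect_poly k = 1" by (simp add: k reflect_poly_mult)
  then have "reflect_poly h dvd 1" by (metis dvd_triv_left)
  then have "degree (reflect_poly h) = 0" by (auto simp: is_unit_poly_iff)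
  then show ?thesis using assms(2) by simp
qed

lemma poly_len_eq:
  assumes "degree h \<le> m"
  shows "poly_len h = (\<Sum>i\<le>m. \<bar>coeff h i\<bar>)"
  unfolding poly_len_def using assms
  by (intro sum.mono_neutral_left) (auto simp: coeff_eq_0)

lemma cmod_poly_le_poly_len:
  fixes f :: "int poly"
  assumes "cmod a \<ge> 1"
  shows "cmod (poly (map_poly of_int f) a) \<le> poly_len f * cmod a ^ degree f"
proof -
  have "poly (map_poly of_int f) a = (\<Sum>i\<le>degree f. of_int (coeff f i) * a ^ i)"
    by (simp add: poly_altdef degree_map_poly coeff_map_poly)
  also have "cmod \<dots> \<le> (\<Sum>i\<le>degree f. \<bar>real_of_int (coeff f i)\<bar> * cmod a ^ degree f)"
    using assms by (intro sum_norm_le) (auto simp: norm_mult norm_power intro!: mult_left_mono power_increasing)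
  also have "\<dots> = poly_len f * cmod a ^ degree f"
    by (simp add: poly_len_def sum_distrib_right)
  finally show ?thesis .
qed

lemma poly_of_int_mult:
  "poly (map_poly of_int (p * q)) (a :: complex) = poly (map_poly of_int p) a * poly (map_poly of_int q) a"
proof -
  have "map_poly of_int (p * q) = (map_poly of_int p * map_poly of_int q :: complex poly)"
    by (rule poly_eqI) (simp add: coeff_map_poly coeff_mult)
  then show ?thesis by simp
qed

section \<open>Square factors of \<open>f + x^n\<close>\<close>

text \<open>The operator \<open>x d/dx - n\<close> annihilates \<open>x^n\<close>, so this is also
  its value at \<open>f + x^n\<close>, yet the degree stays at most that of
  \<open>f\<close>.\<close>

definition euler_poly :: "int poly \<Rightarrow> nat \<Rightarrow> int poly" where
  "euler_poly f n = pCons 0 (pderiv f) - smult (int n) f"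

lemma coeff_euler_poly: "coeff (euler_poly f n) i = (int i - int n) * coeff f i"
  by (cases i) (simp_all add: euler_poly_def coeff_pCons coeff_pderiv algebra_simps)

lemma degree_euler_poly_le: "degree (euler_poly f n) \<le> degree f"
  by (rule degree_le) (simp add: coeff_euler_poly coeff_eq_0)

lemma dvd_euler_poly:
  assumes "h ^ 2 dvd f + monom 1 n"
  shows "h dvd euler_poly f n"
proof -
  obtain u where u: "f + monom 1 n = h * (h * u)"
    using assms unfolding power2_eq_square dvd_def mult.assoc by blast
  have "pderiv (f + monom 1 n) = h * (pderiv (h * u) + u * pderiv h)"
    unfolding u pderiv_mult[of h "h * u"] by (simp add: algebra_simps)
  then have "h dvd [:0, 1:] * pderiv (f + monom 1 n)" by (metis dvd_mult dvd_triv_left)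
  moreover have "h dvd smult (int n) (f + monom 1 n)" unfolding u by (intro dvd_smult) simp
  ultimately have "h dvd pCons 0 (pderiv (f + monom 1 n)) - smult (int n) (f + monom 1 n)"
    by (simp add: dvd_diff)
  also have "pCons 0 (pderiv (f + monom 1 n)) - smult (int n) (f + monom 1 n) = euler_poly f n"
    by (rule poly_eqI)
      (auto simp: coeff_euler_poly coeff_pCons coeff_pderiv algebra_simps split: nat.splits)
  finally show ?thesis .
qed

lemma monic_add_monom:
  fixes f :: "int poly"
  assumes "degree f < n"
  shows "degree (f + monom 1 n) = n" and "lead_coeff (f + monom 1 n) = 1"
proof -
  show deg: "degree (f + monom 1 n) = n"
    using assms by (subst degree_add_eq_right) (simp_all add: degree_monom_eq)
  show "lead_coeff (f + monom 1 n) = 1"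
    unfolding deg using assms by (simp add: coeff_eq_0)
qed

lemma reflect_poly_add_monom:
  fixes f :: "int poly"
  assumes "degree f < n"
  shows "reflect_poly (f + monom 1 n) = 1 + monom 1 (n - degree f) * reflect_poly f"
  using assms monic_add_monom(1)[OF assms]
  by (intro poly_eqI)
    (auto simp: coeff_reflect_poly coeff_monom_mult coeff_1 coeff_eq_0)

text \<open>One witness \<open>h\<close> that the exponent \<open>n\<close> fails. It is taken prime
  so that different witnesses become coprime, and monic for the root estimate.\<close>

locale bad_exponent =
  fixes f :: "int poly" and n :: nat and h :: "int poly"
  assumes not_x2: "\<not> [:0, 1:] ^ 2 dvd f"
    and deg_less: "degree f < n" and deg_pos: "1 \<le> degree f"
    and prime: "prime_elem h" and monic: "lead_coeff h = 1" and h_deg: "degree h \<ge> 1"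
    and sq_dvd: "h ^ 2 dvd f + monom 1 n"
begin

text \<open>If \<open>x\<close> divided \<open>h\<close>, then \<open>x^2\<close> would divide
  \<open>f\<close>, as \<open>n >= 2\<close>.\<close>

lemma coeff_0: "coeff h 0 \<noteq> 0"
proof
  assume "coeff h 0 = 0"
  then have "[:0, 1:] dvd h" using x_power_dvd_iff[of 1 h] by simp
  then have "[:0, 1:] ^ 2 dvd h ^ 2" by (rule dvd_power_same)
  also note sq_dvd
  finally show False using not_x2 deg_less deg_pos by (auto simp: x_power_dvd_iff)
qed

lemma degree_le: "degree h \<le> degree f"
proof -
  have "coeff (euler_poly f n) (degree f) \<noteq> 0"
    using deg_less deg_pos by (auto simp: coeff_euler_poly)
  then have "euler_poly f n \<noteq> 0" by auto
  from dvd_imp_degree_le[OF dvd_euler_poly[OF sq_dvd] this] degree_euler_poly_le[of f n]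
  show ?thesis by simp
qed

lemma not_dvd: "\<not> h dvd f"
proof
  assume "h dvd f"
  moreover have "h dvd f + monom 1 n" using sq_dvd by (simp add: power2_eq_square dvd_mult_left)
  ultimately have "h dvd monom 1 n" by (simp add: dvd_add_right_iff)
  then show False using dvd_monom_imp_degree_0[of h n] coeff_0 h_deg by simp
qed

text \<open>The Euler polynomials for \<open>m\<close> and \<open>n\<close> differ by a nonzero
  constant multiple of \<open>f\<close>. Hence witnesses for different exponents are different
  primes.\<close>

lemma not_dvd_other:
  assumes "m \<noteq> n"
  shows "\<not> h dvd euler_poly f m"
proof
  assume "h dvd euler_poly f m"
  then have "h dvd euler_poly f m - euler_poly f n" using dvd_euler_poly[OF sq_dvd] by (rule dvd_diff)
  also have "euler_poly f m - euler_poly f n = [:int n - int m:] * f"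
    by (rule poly_eqI) (simp add: coeff_euler_poly algebra_simps)
  finally have "h dvd [:int n - int m:]" using prime not_dvd prime_elem_dvd_multD by blast
  then have "degree h \<le> degree [:int n - int m:]" using assms by (intro dvd_imp_degree_le) auto
  then show False using h_deg by simp
qed

text \<open>Put \<open>g = f + x^n\<close> and \<open>d = degree f\<close>. Then \<open>h^2\<close>
  divides \<open>g\<close> and its reversal \<open>rev g\<close>, hence also
  \<open>f rev g - g\<close>, which is \<open>x^(n-d)\<close> times the polynomial here. As
  \<open>h\<close> is coprime to \<open>x\<close>, the power drops out, and what remains is
  independent of \<open>n\<close>.\<close>

lemma reciprocal_dvd:
  assumes "reflect_poly h = h \<or> reflect_poly h = - h"
  shows "h ^ 2 dvd f * reflect_poly f - monom 1 (degree f)"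
proof -
  let ?F = "f * reflect_poly f - monom 1 (degree f)"
  have "reflect_poly (h ^ 2) = h ^ 2" using assms by (auto simp: reflect_poly_power)
  then have "h ^ 2 dvd reflect_poly (f + monom 1 n)"
    using sq_dvd by (metis dvd_def reflect_poly_mult)
  then have "h ^ 2 dvd f * reflect_poly (f + monom 1 n) - (f + monom 1 n)"
    using sq_dvd by (intro dvd_diff dvd_mult)
  also have "f * reflect_poly (f + monom 1 n) - (f + monom 1 n) = monom 1 (n - degree f) * ?F"
  proof -
    have "monom 1 n = (monom 1 (n - degree f) * monom 1 (degree f) :: int poly)"
      using deg_less by (simp add: mult_monom)
    then show ?thesis
      unfolding reflect_poly_add_monom[OF deg_less] by (simp add: algebra_simps)
  qed
  finally have "h ^ 2 dvd monom 1 (n - degree f) * ?F" .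
  moreover have "\<not> h dvd monom 1 (n - degree f)"
    using dvd_monom_imp_degree_0 coeff_0 h_deg by fastforce
  then have "coprime (h ^ 2) (monom 1 (n - degree f))"
    using prime by (simp add: prime_elem_imp_coprime)
  ultimately show ?thesis by (simp add: coprime_dvd_mult_right_iff)
qed

lemma nonreciprocal_bound:
  assumes "reflect_poly h \<noteq> h" and "reflect_poly h \<noteq> - h"
  shows "real n \<le> real (degree f) + 10 * real (degree f) * ln (poly_len f)"
proof -
  let ?d = "degree f"
  obtain a :: complex where a: "poly (map_poly of_int h) a = 0" "cmod a > 1"
    and large: "5 / 4 \<le> cmod a ^ (2 * degree h)"
    using nonreciprocal_large_root[OF monic coeff_0 assms] .
  have "5 / 4 \<le> cmod a ^ (2 * ?d)"
    using large degree_le a(2) by (smt (verit) power_increasing mult_le_mono2)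
  then have "ln (5 / 4) \<le> ln (cmod a ^ (2 * ?d))" using a(2) by (subst ln_le_cancel_iff) auto
  then have 1: "ln (5 / 4) \<le> 2 * real ?d * ln (cmod a)" using a(2) by (simp add: ln_realpow)
  \<comment> \<open>This yields \<open>1/10 <= d ln |a|\<close>, the source of the constant
    10.\<close>
  have "ln (4 / 5 :: real) \<le> 4 / 5 - 1" by (rule ln_le_minus_one) simp
  then have 2: "1 / 5 \<le> ln (5 / 4 :: real)" by (simp add: ln_div)
  have "h dvd f + monom 1 n" using sq_dvd by (simp add: power2_eq_square dvd_mult_left)
  then have "poly (map_poly of_int (f + monom 1 n)) a = 0"
    using a(1) by (auto simp: poly_of_int_mult elim!: dvdE)
  moreover have "map_poly of_int (f + monom 1 n) = (map_poly of_int f + monom 1 n :: complex poly)"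
    by (rule poly_eqI) (simp add: coeff_map_poly)
  ultimately have "a ^ n = - poly (map_poly of_int f) a"
    by (simp add: poly_monom eq_neg_iff_add_eq_0 add.commute)
  then have "cmod a ^ n = cmod (poly (map_poly of_int f) a)" by (metis norm_minus_cancel norm_power)
  also have "\<dots> \<le> poly_len f * cmod a ^ ?d" using a(2) by (intro cmod_poly_le_poly_len) simp
  finally have "cmod a ^ (n - ?d) * cmod a ^ ?d \<le> poly_len f * cmod a ^ ?d"
    using deg_less by (simp flip: power_add)
  then have "cmod a ^ (n - ?d) \<le> poly_len f"
    by (rule mult_right_le_imp_le) (rule zero_less_power, use a(2) in linarith)
  moreover have "0 < cmod a ^ (n - ?d)" by (rule zero_less_power) (use a(2) in linarith)
  ultimately have "ln (cmod a ^ (n - ?d)) \<le> ln (poly_len f)" by (subst ln_le_cancel_iff) linarith+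
  then have 3: "real (n - ?d) * ln (cmod a) \<le> ln (poly_len f)" using a(2) by (simp add: ln_realpow)
  have "real (n - ?d) * (1 / 10) \<le> real (n - ?d) * (real ?d * ln (cmod a))"
    using 1 2 by (intro mult_left_mono) auto
  also have "\<dots> = real ?d * (real (n - ?d) * ln (cmod a))" by simp
  also have "\<dots> \<le> real ?d * ln (poly_len f)" using 3 by (intro mult_left_mono) auto
  finally show ?thesis using deg_less by (simp add: of_nat_diff)
qed

end

section \<open>Finding a good exponent by counting degrees\<close>

text \<open>A prime factor of a monic polynomial has leading coefficient a unit, and normalisation
  of primes makes it 1. This also rules out constant primes.\<close>

lemma not_square_free_imp_bad_exponent:
  assumes "\<not> [:0, 1:] ^ 2 dvd f" and "1 \<le> degree f" and "degree f < n"
    and "\<not> square_free_poly (f + monom 1 n)"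
  shows "\<exists>h. bad_exponent f n h"
proof -
  obtain k where k: "degree k \<ge> 1" "k ^ 2 dvd f + monom 1 n"
    using assms(4) by (auto simp: square_free_poly_def)
  have "k \<noteq> 0" "\<not> k dvd 1" using k(1) by (auto simp: is_unit_poly_iff)
  from prime_divisor_exists[OF this] obtain q where q: "prime q" "q dvd k" by blast
  have sq: "q ^ 2 dvd f + monom 1 n" using k(2) q(2) by (meson dvd_power_same dvd_trans)
  then have "q dvd f + monom 1 n" by (simp add: power2_eq_square dvd_mult_left)
  then have "lead_coeff q dvd 1"
    using monic_add_monom(2)[OF assms(3)] by (metis dvd_def lead_coeff_mult)
  moreover have "lead_coeff q > 0"
  proof -
    have "unit_factor q * q = 1 * q"
      using q(1) unit_factor_mult_normalize[of q] by (simp add: prime_def)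
    then have "unit_factor q = 1" using q(1) by (subst (asm) mult_cancel_right) auto
    then show ?thesis by (simp add: unit_factor_poly_def one_pCons sgn_1_pos)
  qed
  ultimately have lead: "lead_coeff q = 1" by (simp add: zdvd1_eq)
  have "degree q \<noteq> 0"
  proof
    assume "degree q = 0"
    then have "q = 1" using lead by (metis degree_0_id lead_coeff_pCons(2) one_pCons degree_eq_zeroE coeff_pCons_0)
    then show False using q(1) by simp
  qed
  with assms q(1) sq lead have "bad_exponent f n q" by unfold_locales auto
  then show ?thesis ..
qed

lemma reciprocal_product_nonzero:
  fixes f :: "int poly"
  assumes "\<not> [:0, 1:] ^ 2 dvd f" and "2 \<le> degree f"
  shows "f * reflect_poly f \<noteq> monom 1 (degree f)"
proof
  assume *: "f * reflect_poly f = monom 1 (degree f)"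
  have "f \<noteq> 0" using assms by auto
  have "reflect_poly f dvd monom 1 (degree f)" using * by (metis dvd_triv_right)
  then have "degree (reflect_poly f) = 0"
    using \<open>f \<noteq> 0\<close> by (intro dvd_monom_imp_degree_0) auto
  then have "coeff (reflect_poly f) i = 0" if "i > 0" for i using that by (simp add: coeff_eq_0)
  \<comment> \<open>These are the coefficients of \<open>f\<close> at 0 and 1;
    \<open>degree f >= 2\<close> makes both positions in the reversal positive.\<close>
  from this[of "degree f"] this[of "degree f - 1"] assms show False
    by (auto simp: coeff_reflect_poly x_power_dvd_iff less_2_cases_iff split: if_splits)
qed

text \<open>With \<open>x = ln d\<close> this makes the cubed ratio in the final bound at least
  8.\<close>

lemma ratio_ln_ge_2:
  assumes "(x :: real) > 1"
  shows "2 \<le> x / ln x"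
proof -
  have "ln (x / 2) \<le> x / 2 - 1" using assms by (intro ln_le_minus_one) simp
  moreover have "ln (x / 2) = ln x - ln 2" using assms by (simp add: ln_div)
  ultimately have "2 * ln x \<le> x" using ln_2_less_1 by linarith
  then show ?thesis using assms by (simp add: field_simps)
qed



lemma two_le_poly_len:
  assumes "\<not> [:0, 1:] ^ 2 dvd f" and "2 \<le> degree f"
  shows "2 \<le> poly_len f"
proof -
  obtain i where i: "i < 2" "coeff f i \<noteq> 0" using assms(1) by (auto simp: x_power_dvd_iff)
  have "f \<noteq> 0" using assms(2) by auto
  have "(\<Sum>i\<in>{i, degree f}. \<bar>coeff f i\<bar>) \<le> poly_len f"
    unfolding poly_len_def using i assms(2) by (intro sum_mono2) auto
  moreover have "\<bar>coeff f i\<bar> \<ge> 1" "\<bar>lead_coeff f\<bar> \<ge> 1"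
    using i(2) leading_coeff_0_iff[of f] \<open>f \<noteq> 0\<close> by linarith+
  ultimately show ?thesis using i(1) assms(2) by simp
qed

text \<open>If \<open>d + 1\<close> consecutive exponents beyond the nonreciprocal range were all
  bad, they would give \<open>d + 1\<close> pairwise coprime squares of degree at least 2, all
  dividing one nonzero polynomial of degree at most \<open>2 d\<close>.\<close>

lemma square_free_add_monom:
  fixes f :: "int poly"
  assumes "\<not> [:0, 1:] ^ 2 dvd f" and "2 \<le> degree f"
  obtains n where "degree f < n" and "square_free_poly (f + monom 1 n)"
    and "real n \<le> 2 * real (degree f) + 1 + 10 * real (degree f) * ln (poly_len f)"
proof -
  let ?d = "degree f"
  define R where "R = real ?d + 10 * real ?d * ln (poly_len f)"
  \<comment> \<open>\<open>N\<close> is the first integer above \<open>R\<close>, so from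
    \<open>N\<close> on only reciprocal witnesses can occur.\<close>
  define N where "N = nat \<lfloor>R\<rfloor> + 1"
  have "R \<ge> real ?d" using two_le_poly_len[OF assms] by (simp add: R_def)
  then have N: "R < real N" "real N \<le> R + 1" unfolding N_def by linarith+
  then have "?d < N" using \<open>R \<ge> real ?d\<close> by linarith
  have "\<exists>n\<in>{N..N + ?d}. square_free_poly (f + monom 1 n)"
  proof (rule ccontr)
    assume "\<not> ?thesis"
    then have "\<forall>n\<in>{N..N + ?d}. \<exists>h. bad_exponent f n h"
      using not_square_free_imp_bad_exponent assms \<open>?d < N\<close> by auto
    then obtain h where h: "\<And>n. n \<in> {N..N + ?d} \<Longrightarrow> bad_exponent f n (h n)" by metis
    let ?F = "f * reflect_poly f - monom 1 ?d"
    have dvd: "h n ^ 2 dvd ?F" if n: "n \<in> {N..N + ?d}" for n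
    proof -
      have "\<not> real n \<le> R" using n N(1) by auto
      then show ?thesis
        using bad_exponent.nonreciprocal_bound[OF h[OF n]] bad_exponent.reciprocal_dvd[OF h[OF n]]
        unfolding R_def by blast
    qed
    have coprime: "coprime (h n ^ 2) (h m ^ 2)"
      if nm: "n \<in> {N..N + ?d}" "m \<in> {N..N + ?d}" "m \<noteq> n" for n m
    proof -
      have "\<not> h n dvd h m"
        using bad_exponent.not_dvd_other[OF h[OF nm(1)] nm(3)]
          dvd_euler_poly[OF bad_exponent.sq_dvd[OF h[OF nm(2)]]] dvd_trans by blast
      then show ?thesis
        using prime_elem_imp_coprime[OF bad_exponent.prime[OF h[OF nm(1)]]] by simp
    qed
    have "(\<Prod>n\<in>A. h n ^ 2) dvd ?F \<and> 2 * card A \<le> degree (\<Prod>n\<in>A. h n ^ 2)"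
      if "finite A" "A \<subseteq> {N..N + ?d}" for A
      using that
    proof (induction A)
      case (insert n A)
      have "coprime (h n ^ 2) (h m ^ 2)" if "m \<in> A" for m
        using insert.hyps insert.prems that by (intro coprime) auto
      then have "h n ^ 2 * (\<Prod>n\<in>A. h n ^ 2) dvd ?F"
        using insert dvd by (intro divides_mult prod_coprime_right) auto
      moreover have "degree (h m) \<ge> 1" if "m \<in> insert n A" for m
        using bad_exponent.h_deg[OF h] that insert.prems by auto
      then have "h m \<noteq> 0 \<and> degree (h m ^ 2) \<ge> 2" if "m \<in> insert n A" for m
        using that by (metis degree_0 degree_power_eq mult_le_mono1 mult_1 mult.commute not_one_le_zero)
      then have "degree (h n ^ 2) \<ge> 2" and "h n ^ 2 \<noteq> 0" and "(\<Prod>n\<in>A. h n ^ 2) \<noteq> 0"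
        using insert.hyps by auto
      moreover have "2 * card A \<le> degree (\<Prod>n\<in>A. h n ^ 2)" using insert by simp
      ultimately show ?case using insert.hyps by (simp add: degree_mult_eq)
    qed simp
    from this[of "{N..N + ?d}"] have dvd_F: "(\<Prod>n\<in>{N..N + ?d}. h n ^ 2) dvd ?F"
      and deg: "2 * (?d + 1) \<le> degree (\<Prod>n\<in>{N..N + ?d}. h n ^ 2)" by auto
    have "?F \<noteq> 0" using reciprocal_product_nonzero[OF assms] by simp
    from dvd_imp_degree_le[OF dvd_F this] deg have "2 * (?d + 1) \<le> degree ?F" by simp
    also have "degree ?F \<le> 2 * ?d"
      using degree_mult_le[of f "reflect_poly f"] degree_reflect_poly_le[of f]
      by (intro degree_diff_le) (auto simp: degree_monom_eq)
    finally show False by simp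
  qed
  then obtain n where "n \<in> {N..N + ?d}" "square_free_poly (f + monom 1 n)" by blast
  then show thesis using that[of n] N \<open>?d < N\<close> by (simp add: R_def)
qed

section \<open>Comparison with the stated bound\<close>

text \<open>The quadratic estimate of \<open>exp\<close> at 1 only gives \<open>e <= 3\<close>; used
  at \<open>1/4\<close> it gives \<open>e <= (21/16)^4 < 3\<close>.\<close>

lemma one_less_ln:
  assumes "d \<ge> 3"
  shows "1 < ln (real d)"
proof -
  have "exp (1 / 4 :: real) \<le> 1 + 1 / 4 + (1 / 4)\<^sup>2" by (rule exp_bound) auto
  then have "exp (1 / 4 :: real) ^ 4 \<le> (1 + 1 / 4 + (1 / 4)\<^sup>2) ^ 4" by (rule power_mono) simp
  also have "\<dots> < (3 :: real)" by (simp add: power2_eq_square power4_eq_xxxx)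
  finally have "exp (4 * (1 / 4 :: real)) < 3"
    using exp_of_nat_mult[of 4 "1 / 4 :: real"] by simp
  then have "exp 1 < exp (ln (real d))" using assms by simp
  then show ?thesis by (simp only: exp_less_cancel_iff)
qed

text \<open>The cubed ratio is at least 8 and \<open>2.2 * 8 = 17.6\<close>, which leaves
  \<open>7.6 d l >= 3.8 d\<close> to absorb \<open>2 d + 1\<close>.\<close>

lemma exponent_bound:
  assumes "real n \<le> 2 * real d + 1 + 10 * real d * l" and "d \<ge> 3" and "l \<ge> ln 2"
  shows "real n < 2.2 * real d * (ln (real d) / ln (ln (real d))) ^ 3 * l"
proof -
  have "ln (1 / 2 :: real) \<le> 1 / 2 - 1" by (rule ln_le_minus_one) simp
  then have l: "l \<ge> 1 / 2" using assms(3) by (simp add: ln_div)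
  have "ln (real d) > 1" using assms(2) by (rule one_less_ln)
  then have "2 \<le> ln (real d) / ln (ln (real d))" by (rule ratio_ln_ge_2)
  from power_mono[OF this, of 3] have *: "8 \<le> (ln (real d) / ln (ln (real d))) ^ 3" by simp
  have "real d * (1 / 2) \<le> real d * l" using l by (intro mult_left_mono) auto
  then have "2 * real d + 1 + 10 * (real d * l) < 17.6 * (real d * l)"
    using of_nat_mono[OF assms(2), where ?'a = real] by linarith
  then have "2 * real d + 1 + 10 * real d * l < 2.2 * real d * 8 * l" by simp
  also have "\<dots> \<le> 2.2 * real d * (ln (real d) / ln (ln (real d))) ^ 3 * l"
    using * l by (intro mult_right_mono mult_left_mono) auto
  finally show ?thesis using assms(1) by simp
qed

theorem theorem1p5:
  fixes f :: "int poly" and d :: nat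
  assumes "degree f = d" and "d \<ge> 3"
  shows "(\<not> [:0, 1:] ^ 2 dvd f \<longrightarrow>
           (\<exists>g :: int poly. square_free_poly g \<and>
              real (degree g) < 2.2 * real d * (ln (real d) / ln (ln (real d))) ^ 3
                                  * ln (real_of_int (poly_len f)) \<and>
              poly_len (f - g) = 1)) \<and>
         (\<exists>g :: int poly. square_free_poly g \<and>
              real (degree g) < 2.2 * real d * (ln (real d) / ln (ln (real d))) ^ 3
                                  * ln (real_of_int (poly_len f) + 1) \<and>
              poly_len (f - g) \<le> 2 \<and>
              ([:0, 1:] ^ 2 dvd f \<longrightarrow> poly_len (f - g) = 2))"
proof -
  define B where "B l = 2.2 * real d * (ln (real d) / ln (ln (real d))) ^ 3 * l" for l
  have near: "\<exists>n. d < n \<and> square_free_poly (p + monom 1 n) \<and>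
      real (degree (p + monom 1 n)) < B (ln (poly_len p))"
    if p: "\<not> [:0, 1:] ^ 2 dvd p" "degree p = d" for p :: "int poly"
  proof -
    have "2 \<le> degree p" using p(2) assms(2) by simp
    from square_free_add_monom[OF p(1) this] obtain n
      where n: "d < n" "square_free_poly (p + monom 1 n)"
        "real n \<le> 2 * real d + 1 + 10 * real d * ln (poly_len p)" using p(2) by metis
    have "ln (poly_len p) \<ge> ln 2" using two_le_poly_len[OF p(1) \<open>2 \<le> degree p\<close>] by simp
    from exponent_bound[OF n(3) assms(2) this] n(1,2) monic_add_monom(1)[of p n] p(2)
    show ?thesis by (auto simp: B_def)
  qed
  have len: "poly_len (- monom 1 n) = 1" for n
    by (simp add: poly_len_def degree_monom_eq if_distrib cong: if_cong)
  have 1: "\<exists>g. square_free_poly g \<and> real (degree g) < B (ln (poly_len f)) \<and> poly_len (f - g) = 1"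
    if "\<not> [:0, 1:] ^ 2 dvd f"
  proof -
    from near[OF that assms(1)] obtain n where
      "square_free_poly (f + monom 1 n)" "real (degree (f + monom 1 n)) < B (ln (poly_len f))"
      by blast
    then show ?thesis by (intro exI[of _ "f + monom 1 n"]) (simp add: len)
  qed
  have 2: "\<exists>g. square_free_poly g \<and> real (degree g) < B (ln (real_of_int (poly_len f) + 1)) \<and> poly_len (f - g) \<le> 2 \<and>
      ([:0, 1:] ^ 2 dvd f \<longrightarrow> poly_len (f - g) = 2)"
  proof (cases "[:0, 1:] ^ 2 dvd f")
    case False
    then obtain g where g: "square_free_poly g" "real (degree g) < B (ln (poly_len f))" "poly_len (f - g) = 1"
      using 1 by blast
    have "2 \<le> poly_len f" using two_le_poly_len[OF False] assms by simp
    then have "ln (poly_len f) \<le> ln (poly_len f + 1)" by simp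
    moreover have "0 \<le> (ln (real d) / ln (ln (real d))) ^ 3"
      using one_less_ln[OF assms(2)] by simp
    ultimately have "B (ln (poly_len f)) \<le> B (ln (real_of_int (poly_len f) + 1))"
      unfolding B_def by (intro mult_left_mono) auto
    with g False show ?thesis by (intro exI[of _ g]) auto
  next
    case True
    \<comment> \<open>Passing to \<open>f + 1\<close> destroys divisibility by \<open>x^2\<close>.
      Since the constant term of \<open>f\<close> is 0, the length grows by exactly 1, whence
      \<open>L(f) + 1\<close> in the bound, and \<open>f - g\<close> becomes
      \<open>-1 - x^n\<close>.\<close>
    have f0: "coeff f 0 = 0" using True by (auto simp: x_power_dvd_iff)
    have deg: "degree (f + 1) = d" using assms by (simp add: degree_add_eq_left)
    have "\<not> [:0, 1:] ^ 2 dvd f + 1" using f0 by (auto simp: x_power_dvd_iff intro!: exI[of _ 0])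
    from near[OF this deg] obtain n where n: "d < n" "square_free_poly (f + 1 + monom 1 n)"
      "real (degree (f + 1 + monom 1 n)) < B (ln (poly_len (f + 1)))" by blast
    have "poly_len (f + 1) = (\<Sum>i\<le>d. \<bar>coeff f i\<bar> + (if i = 0 then 1 else 0))"
      unfolding poly_len_def deg using f0 by (intro sum.cong) auto
    then have "poly_len (f + 1) = poly_len f + 1"
      using assms(1) by (simp add: poly_len_def sum.distrib)
    moreover have "poly_len (f - (f + 1 + monom 1 n)) = 2"
    proof -
      have "poly_len (f - (f + 1 + monom 1 n)) = (\<Sum>i\<le>n. \<bar>coeff (- 1 - monom 1 n :: int poly) i\<bar>)"
        by (subst poly_len_eq[of _ n]) (auto intro!: degree_diff_le simp: degree_monom_eq)
      also have "\<dots> = (\<Sum>i\<le>n. (if i = 0 then 1 else 0) + (if i = n then 1 else 0))"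
        using n(1) by (intro sum.cong) auto
      finally show ?thesis by (simp add: sum.distrib)
    qed
    ultimately show ?thesis using n by (intro exI[of _ "f + 1 + monom 1 n"]) simp
  qed
  show ?thesis using 1 2 unfolding B_def by (intro conjI impI)
qed

end
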